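(* Fix $\varepsilon > 0$, let $\alpha_1, \alpha_2, \ldots$ be a sequence of elements of $\mathcal K$, and let $\gamma_1, \gamma_2, \ldots$ be a sequence of real numbers. Then for Lebesgue-almost all $\beta \in \mathbb R$ the following holds: for every $i \in \mathbb N$ and every $\delta \in \mathbb R$, the inequality \[ n \| n\alpha_i - \gamma_i \| \cdot \| n\beta - \delta \| < \frac{(\log\log\log n)^{\varepsilon + 1/2}}{(\log n)^{1/2}} \] has infinitely many solutions $n \in \mathbb N$.
   Context: For $x \in \mathbb R$, $\|x\| = \min\{|x-k| : k \in \mathbb Z\}$ denotes the distance to the nearest integer. For irrational $\alpha = [a_0; a_1, a_2, \ldots]$ (continued fraction expansion), the continued fraction convergent denominators are defined by $q_{-1} = 0$, $q_0 = 1$, $q_k = a_k q_{k-1} + q_{k-2}$ for $k \in \mathbb N$. The set $\mathcal K$ is defined as $\mathcal K = \{\alpha \in \mathbb R \setminus \mathbb Q : \sup\{ t^{-1}\log q_t(\alpha) : t \in \mathbb N\} < \infty\}$, where $q_t(\alpha)$ are the continued fraction denominators of $\alpha$. *)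

theory Defs
  imports "HOL-Analysis.Analysis"
begin

definition nint_dist :: "real \<Rightarrow> real" where
  "nint_dist x = (INF k::int. \<bar>x - of_int k\<bar>)"

text \<open>The infimum is attained, so it is the minimum over the integers.\<close>

lemma nint_dist_eq_round: "nint_dist x = \<bar>x - of_int (round x)\<bar>"
  unfolding nint_dist_def
proof (rule cInf_eq_minimum)
  fix y assume "y \<in> range (\<lambda>k::int. \<bar>x - of_int k\<bar>)"
  then obtain k :: int where "y = \<bar>x - of_int k\<bar>" by auto
  then show "\<bar>x - of_int (round x)\<bar> \<le> y"
    using round_diff_minimal[of x k] by simp
qed auto

text \<open>Complete quotients: \<open>x\<^sub>0 = \<alpha>\<close> and \<open>x\<^bsub>k+1\<^esub> = 1 / (x\<^sub>k - \<lfloor>x\<^sub>k\<rfloor>)\<close>. For irrational \<open>\<alpha>\<close> the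
  denominator never vanishes; for rational \<open>\<alpha>\<close> the values after termination are meaningless.\<close>

primrec cf_complete :: "real \<Rightarrow> nat \<Rightarrow> real" where
  "cf_complete \<alpha> 0 = \<alpha>"
| "cf_complete \<alpha> (Suc k) = 1 / frac (cf_complete \<alpha> k)"

definition cf_quotient :: "real \<Rightarrow> nat \<Rightarrow> int" where
  "cf_quotient \<alpha> k = \<lfloor>cf_complete \<alpha> k\<rfloor>"

text \<open>The second equation is the general recurrence with the convention \<open>q\<^bsub>-1\<^esub> = 0\<close>.\<close>

fun cf_denom :: "real \<Rightarrow> nat \<Rightarrow> int" where
  "cf_denom \<alpha> 0 = 1"
| "cf_denom \<alpha> (Suc 0) = cf_quotient \<alpha> 1 * cf_denom \<alpha> 0 + 0"
| "cf_denom \<alpha> (Suc (Suc k)) =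
     cf_quotient \<alpha> (Suc (Suc k)) * cf_denom \<alpha> (Suc k) + cf_denom \<alpha> k"

text \<open>Finiteness of the supremum is expressed by \<^const>\<open>bdd_above\<close>, since \<^const>\<open>Sup\<close> on the reals is
  unspecified for unbounded sets.\<close>

definition K_set :: "real set" where
  "K_set = {\<alpha>. \<alpha> \<notin> \<rat> \<and>
     bdd_above {ln (real_of_int (cf_denom \<alpha> t)) / real t | t::nat. t \<ge> 1}}"

end

theory Submission
  imports Defs "HOL-Number_Theory.Cong" "HOL-Real_Asymp.Real_Asymp"
begin

text \<open>
  For each convergent denominator \<open>q\<^sub>t\<close> of \<open>\<alpha>\<close> the residue classes modulo \<open>q\<^sub>t\<close> provide an
  \<open>n\<^sub>t \<in> [q\<^sub>t, 2q\<^sub>t)\<close> with \<open>n\<^sub>t \<parallel>n\<^sub>t\<alpha> - \<gamma>\<parallel> \<le> 5\<close>. Passing to every fourth index makes \<open>n\<^sub>t\<close>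
  lacunary, and \<open>\<alpha> \<in> \<K>\<close> gives \<open>log n\<^sub>t = O(t)\<close>. If a sequence grows by a factor of at least
  \<open>8/\<eta>\<close> in each step, the set of \<open>\<beta>\<close> whose first \<open>K\<close> dilates all miss a given arc of length
  \<open>\<eta>\<close> has relative measure at most \<open>(1 - \<eta>/2)\<^sup>K\<close>. Thinning the lacunary sequence
  logarithmically and summing over \<open>2\<^sup>j\<close> arcs, Borel-Cantelli shows that, for almost every
  \<open>\<beta>\<close> and all large \<open>j\<close>, every \<open>\<delta>\<close> is within \<open>2/2\<^sup>j\<close> of some \<open>n\<^sub>t\<beta>\<close> modulo 1 with
  \<open>t = O(j\<^sup>2 2\<^sup>j)\<close>. This is much denser than the required \<open>t\<^bsup>-1/2\<^esup>\<close>.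
\<close>

section \<open>Distance to the nearest integer\<close>

lemma nint_dist_le: "nint_dist x \<le> \<bar>x - of_int k\<bar>"
  unfolding nint_dist_eq_round using round_diff_minimal[of x k] by simp

lemma nint_dist_nonneg: "0 \<le> nint_dist x"
  by (simp add: nint_dist_eq_round)

text \<open>The distance is 1-periodic, so \<open>y\<close> may be compared with any integer; this
  later moves a target \<delta> to a grid point modulo 1.\<close>

lemma nint_dist_triangle: "nint_dist (x + y) \<le> nint_dist x + \<bar>y - of_int k\<bar>"
  using nint_dist_le[of "x + y" "round x + k"] unfolding nint_dist_eq_round[of x] by simp

lemma nint_dist_measurable [measurable]: "nint_dist \<in> borel_measurable borel"
  unfolding nint_dist_eq_round[abs_def] round_def by measurable

section \<open>Convergents of the continued fraction and their errors\<close>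

text \<open>The second equation is the general recurrence with the convention p_(-1) = 1.\<close>

fun cf_numer :: "real \<Rightarrow> nat \<Rightarrow> int" where
  "cf_numer \<alpha> 0 = cf_quotient \<alpha> 0"
| "cf_numer \<alpha> (Suc 0) = cf_quotient \<alpha> 1 * cf_quotient \<alpha> 0 + 1"
| "cf_numer \<alpha> (Suc (Suc k)) =
     cf_quotient \<alpha> (Suc (Suc k)) * cf_numer \<alpha> (Suc k) + cf_numer \<alpha> k"

text \<open>The two recurrences cancel the partial quotient, so the determinant only changes sign
  from step to step; the absolute value avoids tracking that sign.\<close>

lemma cf_determinant:
  "\<bar>cf_numer \<alpha> (Suc k) * cf_denom \<alpha> k - cf_numer \<alpha> k * cf_denom \<alpha> (Suc k)\<bar> = 1"
proof (induction k)
  case 0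
  show ?case by simp
next
  case (Suc k)
  have "cf_numer \<alpha> (Suc (Suc k)) * cf_denom \<alpha> (Suc k) - cf_numer \<alpha> (Suc k) * cf_denom \<alpha> (Suc (Suc k))
      = - (cf_numer \<alpha> (Suc k) * cf_denom \<alpha> k - cf_numer \<alpha> k * cf_denom \<alpha> (Suc k))"
    by (simp add: algebra_simps)
  with Suc show ?case by simp
qed

text \<open>A common divisor divides the determinant. Coprimality makes the numerator invertible
  modulo the denominator.\<close>

lemma cf_coprime: "coprime (cf_numer \<alpha> k) (cf_denom \<alpha> k)"
proof (rule coprimeI)
  fix c assume "c dvd cf_numer \<alpha> k" "c dvd cf_denom \<alpha> k"
  then have "c dvd cf_numer \<alpha> (Suc k) * cf_denom \<alpha> k - cf_numer \<alpha> k * cf_denom \<alpha> (Suc k)"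
    by simp
  then have "c dvd \<bar>cf_numer \<alpha> (Suc k) * cf_denom \<alpha> k - cf_numer \<alpha> k * cf_denom \<alpha> (Suc k)\<bar>"
    by (simp only: dvd_abs_iff)
  then show "is_unit c" by (simp only: cf_determinant)
qed

lemma cf_complete_irrational:
  assumes "\<alpha> \<notin> \<rat>" shows "cf_complete \<alpha> k \<notin> \<rat>"
proof (induction k)
  case 0
  show ?case using assms by simp
next
  case (Suc k)
  show ?case
  proof
    assume "cf_complete \<alpha> (Suc k) \<in> \<rat>"
    then have "frac (cf_complete \<alpha> k) \<in> \<rat>"
      using Rats_inverse by (fastforce simp: divide_inverse)
    then have "frac (cf_complete \<alpha> k) + of_int \<lfloor>cf_complete \<alpha> k\<rfloor> \<in> \<rat>"
      by (intro Rats_add Rats_of_int)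
    then show False using Suc by (simp add: frac_def)
  qed
qed

lemma cf_frac_bounds:
  assumes "\<alpha> \<notin> \<rat>"
  shows "0 < frac (cf_complete \<alpha> k)" "frac (cf_complete \<alpha> k) < 1"
proof -
  have "cf_complete \<alpha> k \<notin> \<int>"
    using cf_complete_irrational[OF assms, of k] Ints_subset_Rats by blast
  then show "0 < frac (cf_complete \<alpha> k)"
    by (simp add: frac_gt_0_iff)
qed (rule frac_lt_1)

lemma cf_quotient_ge_1:
  assumes "\<alpha> \<notin> \<rat>" shows "1 \<le> cf_quotient \<alpha> (Suc k)"
  using cf_frac_bounds[OF assms, of k] by (simp add: cf_quotient_def le_floor_iff)

lemma cf_denom_mono:
  assumes "\<alpha> \<notin> \<rat>" shows "1 \<le> cf_denom \<alpha> k \<and> cf_denom \<alpha> k \<le> cf_denom \<alpha> (Suc k)"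
proof (induction k)
  case 0
  show ?case using cf_quotient_ge_1[OF assms, of 0] by simp
next
  case (Suc k)
  have "1 * cf_denom \<alpha> (Suc k) \<le> cf_quotient \<alpha> (Suc (Suc k)) * cf_denom \<alpha> (Suc k)"
    using Suc cf_quotient_ge_1[OF assms, of "Suc k"] by (intro mult_right_mono) auto
  then have "cf_denom \<alpha> (Suc k) + cf_denom \<alpha> k \<le> cf_denom \<alpha> (Suc (Suc k))" by simp
  with Suc show ?case by linarith
qed

text \<open>One step need not double the denominator, since the partial quotient may be 1; two steps
  always do.\<close>

lemma cf_denom_double:
  assumes "\<alpha> \<notin> \<rat>" shows "2 * cf_denom \<alpha> k \<le> cf_denom \<alpha> (Suc (Suc k))"
proof -
  have "1 * cf_denom \<alpha> (Suc k) \<le> cf_quotient \<alpha> (Suc (Suc k)) * cf_denom \<alpha> (Suc k)"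
    using cf_denom_mono[OF assms, of "Suc k"] cf_quotient_ge_1[OF assms, of "Suc k"]
    by (intro mult_right_mono) auto
  then have "cf_denom \<alpha> (Suc k) + cf_denom \<alpha> k \<le> cf_denom \<alpha> (Suc (Suc k))" by simp
  then show ?thesis using cf_denom_mono[OF assms, of k] by linarith
qed

definition cf_error :: "real \<Rightarrow> nat \<Rightarrow> real" where
  "cf_error \<alpha> k = real_of_int (cf_denom \<alpha> k) * \<alpha> - real_of_int (cf_numer \<alpha> k)"

text \<open>The errors satisfy the recurrence of numerators and denominators. By induction the ratio
  of consecutive errors is, up to sign, a complete quotient, and subtracting its integer part leaves
  its fractional part.\<close>

lemma cf_error_Suc:
  assumes "\<alpha> \<notin> \<rat>"
  shows "cf_error \<alpha> (Suc k) = - cf_error \<alpha> k * frac (cf_complete \<alpha> (Suc k))"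
proof (induction k)
  case 0
  define f where "f = frac \<alpha>"
  have f: "f \<noteq> 0" using cf_frac_bounds(1)[OF assms, of 0] by (simp add: f_def)
  have "cf_error \<alpha> (Suc 0) = real_of_int (cf_quotient \<alpha> 1) * f - 1"
    by (simp add: cf_error_def f_def frac_def cf_quotient_def algebra_simps)
  also have "\<dots> = - f * (1 / f - real_of_int (cf_quotient \<alpha> 1))"
    using f by (simp add: algebra_simps)
  also have "\<dots> = - cf_error \<alpha> 0 * frac (cf_complete \<alpha> (Suc 0))"
    by (simp add: cf_error_def cf_quotient_def f_def frac_def)
  finally show ?case .
next
  case (Suc k)
  define x where "x = cf_complete \<alpha> (Suc k)"
  have x: "frac x \<noteq> 0" using cf_frac_bounds(1)[OF assms, of "Suc k"] by (simp add: x_def)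
  have prev: "cf_error \<alpha> k = - cf_error \<alpha> (Suc k) * (1 / frac x)"
    using Suc x by (simp add: x_def)
  have "cf_error \<alpha> (Suc (Suc k))
      = cf_quotient \<alpha> (Suc (Suc k)) * cf_error \<alpha> (Suc k) + cf_error \<alpha> k"
    by (simp add: cf_error_def algebra_simps)
  also have "\<dots> = - cf_error \<alpha> (Suc k) * (1 / frac x - cf_quotient \<alpha> (Suc (Suc k)))"
    unfolding prev by (simp add: algebra_simps)
  also have "\<dots> = - cf_error \<alpha> (Suc k) * frac (cf_complete \<alpha> (Suc (Suc k)))"
    by (simp add: frac_def[of "1 / _"] cf_quotient_def x_def)
  finally show ?case .
qed

text \<open>This is the determinant relation rewritten with errors: consecutive errors have opposite
  signs, so the difference becomes a sum of absolute values.\<close>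

lemma cf_error_identity:
  assumes "\<alpha> \<notin> \<rat>"
  shows "cf_denom \<alpha> (Suc k) * \<bar>cf_error \<alpha> k\<bar> + cf_denom \<alpha> k * \<bar>cf_error \<alpha> (Suc k)\<bar> = 1"
proof -
  have "(cf_denom \<alpha> (Suc k) * cf_error \<alpha> k - cf_denom \<alpha> k * cf_error \<alpha> (Suc k))
      = of_int (cf_numer \<alpha> (Suc k) * cf_denom \<alpha> k - cf_numer \<alpha> k * cf_denom \<alpha> (Suc k))"
    by (simp add: cf_error_def algebra_simps)
  then have "\<bar>cf_denom \<alpha> (Suc k) * cf_error \<alpha> k - cf_denom \<alpha> k * cf_error \<alpha> (Suc k)\<bar> = 1"
    by (metis cf_determinant of_int_1 of_int_abs)
  then have *: "\<bar>cf_error \<alpha> k * (cf_denom \<alpha> (Suc k) + cf_denom \<alpha> k * frac (cf_complete \<alpha> (Suc k)))\<bar> = 1"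
    unfolding cf_error_Suc[OF assms] by (simp add: algebra_simps)
  have "0 < cf_denom \<alpha> k" "0 < cf_denom \<alpha> (Suc k)"
    using cf_denom_mono[OF assms, of k] by auto
  then have "0 < cf_denom \<alpha> (Suc k) + cf_denom \<alpha> k * frac (cf_complete \<alpha> (Suc k))"
    using cf_frac_bounds(1)[OF assms, of "Suc k"] by (intro add_pos_pos mult_pos_pos) auto
  with * have "\<bar>cf_error \<alpha> k\<bar> * (cf_denom \<alpha> (Suc k) + cf_denom \<alpha> k * frac (cf_complete \<alpha> (Suc k))) = 1"
    by (simp only: abs_mult abs_of_pos)
  moreover have "\<bar>cf_error \<alpha> (Suc k)\<bar> = \<bar>cf_error \<alpha> k\<bar> * frac (cf_complete \<alpha> (Suc k))"
    unfolding cf_error_Suc[OF assms] by (simp only: abs_mult abs_minus_cancel abs_of_nonneg[OF frac_ge_0])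
  ultimately show ?thesis by (simp only: algebra_simps)
qed

lemma cf_error_bound:
  assumes "\<alpha> \<notin> \<rat>" shows "cf_denom \<alpha> k * \<bar>cf_error \<alpha> k\<bar> \<le> 1"
proof -
  have "cf_denom \<alpha> k * \<bar>cf_error \<alpha> k\<bar> \<le> cf_denom \<alpha> (Suc k) * \<bar>cf_error \<alpha> k\<bar>"
    using cf_denom_mono[OF assms, of k] by (intro mult_right_mono) auto
  also have "\<dots> \<le> 1"
  proof -
    have "0 \<le> cf_denom \<alpha> k * \<bar>cf_error \<alpha> (Suc k)\<bar>"
      using cf_denom_mono[OF assms, of k] by (intro mult_nonneg_nonneg) auto
    then show ?thesis using cf_error_identity[OF assms, of k] by linarith
  qed
  finally show ?thesis .
qed

section \<open>Inhomogeneous approximation through residue classes\<close>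

text \<open>Replace \<alpha> by p/q and \<gamma> by the nearest c/q. Since p is invertible modulo q,
  some n in any block of q consecutive integers satisfies n p = c modulo q, and only the two
  replacement errors remain.\<close>

lemma inhomogeneous_approximation:
  assumes "\<alpha> \<notin> \<rat>"
  obtains n :: nat where "cf_denom \<alpha> k \<le> int n" "int n < 2 * cf_denom \<alpha> k"
    "real n * nint_dist (real n * \<alpha> - \<gamma>) \<le> 5"
proof -
  define p q where "p = cf_numer \<alpha> k" and "q = cf_denom \<alpha> k"
  have q: "1 \<le> q" using cf_denom_mono[OF assms, of k] by (simp add: q_def)
  have "coprime p q" unfolding p_def q_def by (rule cf_coprime)
  then obtain r where r: "[p * r = 1] (mod q)"
    using cong_solve_coprime_int by blast
  define c where "c = round (\<gamma> * q)"
  \<comment> \<open>Adding \<open>q\<close> to the residue forces \<open>n\<close> to be at least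
    \<open>q\<close>, so that \<open>n\<close> inherits the growth of the denominators.\<close>
  define n where "n = nat (q + (r * c) mod q)"
  have n: "int n = q + (r * c) mod q"
    using q by (simp add: n_def)
  have bounds: "q \<le> int n" "int n < 2 * q"
    using q by (auto simp: n)
  have "[int n = r * c] (mod q)" by (simp add: n cong_def)
  then have "[int n * p = (r * c) * p] (mod q)" by (rule cong_scalar_right)
  also have "(r * c) * p = (p * r) * c" by simp
  also have "[(p * r) * c = 1 * c] (mod q)" using r by (rule cong_scalar_right)
  finally have "[int n * p = c] (mod q)" by simp
  then obtain l where l: "int n * p = c + q * l"
    by (metis cong_iff_lin cong_sym)
  have lr: "real n * real_of_int p = c + real_of_int q * l"
    using arg_cong[OF l, of real_of_int] by simp
  have qr: "1 \<le> real_of_int q" "real_of_int q \<le> real n" "real n \<le> 2 * real_of_int q"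
    using q bounds by linarith+
  define \<theta> where "\<theta> = cf_error \<alpha> k"
  have \<theta>: "real_of_int q * \<bar>\<theta>\<bar> \<le> 1"
    using cf_error_bound[OF assms, of k] by (simp add: \<theta>_def q_def)
  \<comment> \<open>Since n p = c + q l, the multiples of 1/q cancel. The first remaining term is at
    most 2 in absolute value, the rounding term at most 1/2.\<close>
  have "real_of_int q * (real n * \<alpha> - \<gamma> - l) = real n * \<theta> + (c - \<gamma> * q)"
    using lr by (simp add: \<theta>_def cf_error_def p_def q_def algebra_simps)
  then have "real_of_int q * \<bar>real n * \<alpha> - \<gamma> - l\<bar> = \<bar>real n * \<theta> + (c - \<gamma> * q)\<bar>"
    using qr by (metis abs_mult abs_of_nonneg order_trans zero_le_one)
  also have "\<dots> \<le> real n * \<bar>\<theta>\<bar> + \<bar>c - \<gamma> * q\<bar>"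
    by (metis abs_triangle_ineq abs_mult abs_of_nat)
  also have "\<bar>c - \<gamma> * q\<bar> \<le> 1 / 2"
    unfolding c_def by (rule of_int_round_abs_le)
  also have "real n * \<bar>\<theta>\<bar> \<le> 2 * real_of_int q * \<bar>\<theta>\<bar>"
    using qr by (intro mult_right_mono) auto
  finally have *: "real_of_int q * \<bar>real n * \<alpha> - \<gamma> - l\<bar> \<le> 5 / 2"
    using \<theta> by simp
  \<comment> \<open>Passing from \<open>q\<close> to \<open>n\<close> costs a factor of at most 2,
    which turns 5/2 into 5.\<close>
  have "real n * nint_dist (real n * \<alpha> - \<gamma>) \<le> 2 * real_of_int q * \<bar>real n * \<alpha> - \<gamma> - l\<bar>"
    using qr by (intro mult_mono nint_dist_le nint_dist_nonneg) auto
  also have "\<dots> \<le> 5" using * by simp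
  finally show thesis using that bounds by (simp add: q_def)
qed

section \<open>Measure of the points whose dilates avoid an arc\<close>

lemma fmeasurable_borel_Int_Icc:
  fixes S :: "real set"
  assumes "S \<in> sets borel" shows "S \<inter> {s..t} \<in> fmeasurable lborel"
proof (rule fmeasurableI2)
  show "{s..t} \<in> fmeasurable lborel"
    using fmeasurable_cbox[of s t] by (simp only: box_real)
qed (use assms in auto)

text \<open>The condition on the dilate by \<open>m\<close> leaves intervals of length (1 -
  \<eta>)/m, still long enough for \<open>H\<close>. At most m l + 2 of them meet the window; the
  surplus 2 costs at most a factor 1 + \<eta>/2, and (1 - \<eta>)(1 + \<eta>/2) \<le> 1 -
  \<eta>/2.\<close>

lemma measure_avoid_step:
  fixes S :: "real set"
  assumes S [measurable]: "S \<in> sets borel"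
    and \<eta>: "0 < \<eta>" "\<eta> \<le> 1 / 2" and m0: "0 < m0" and m: "8 / \<eta> * m0 \<le> m" and c: "0 \<le> c"
    and H: "\<And>a l. 1 / (2 * m) \<le> l \<Longrightarrow> measure lborel (S \<inter> {a..a + l}) \<le> c * l"
    and l: "1 / (2 * m0) \<le> l"
  shows "measure lborel ({b \<in> S. \<eta> / 2 \<le> nint_dist (m * b - x)} \<inter> {a..a + l})
    \<le> c * (1 - \<eta> / 2) * l"
proof -
  have m_pos: "0 < m"
  proof -
    have "0 < 8 / \<eta> * m0" using \<eta> m0 by simp
    then show ?thesis using m by linarith
  qed
  have l_pos: "0 < l"
  proof -
    have "0 < 1 / (2 * m0)" using m0 by simp
    then show ?thesis using l by linarith
  qed
  \<comment> \<open>\<open>I\<close> lists the \<open>k\<close> for which [\<open>u k\<close>,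
    \<open>u k + w\<close>] meets the window; that interval consists of the \<open>b\<close> with
    \<open>m * b - x\<close> between k + \<eta>/2 and k + 1 - \<eta>/2.\<close>
  define I where "I = {\<lceil>m * a - x - 1 + \<eta> / 2\<rceil>..\<lfloor>m * (a + l) - x - \<eta> / 2\<rfloor>}"
  define u where "u k = (x + of_int k + \<eta> / 2) / m" for k :: int
  define w where "w = (1 - \<eta>) / m"
  have u_le: "u k \<le> b \<longleftrightarrow> x + of_int k + \<eta> / 2 \<le> m * b" for k b
    using m_pos by (simp add: u_def field_simps)
  have uw: "u k + w = (x + of_int k + 1 - \<eta> / 2) / m" for k
    by (simp add: u_def w_def add_divide_distrib[symmetric])
  have uw_ge: "b \<le> u k + w \<longleftrightarrow> m * b \<le> x + of_int k + 1 - \<eta> / 2" for k b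
    unfolding uw using m_pos by (simp add: field_simps)
  have sub: "{b \<in> S. \<eta> / 2 \<le> nint_dist (m * b - x)} \<inter> {a..a + l}
      \<subseteq> (\<Union>k\<in>I. S \<inter> {u k..u k + w})"
  proof
    fix b assume b: "b \<in> {b \<in> S. \<eta> / 2 \<le> nint_dist (m * b - x)} \<inter> {a..a + l}"
    define k where "k = \<lfloor>m * b - x\<rfloor>"
    have "\<eta> / 2 \<le> \<bar>m * b - x - of_int k\<bar>" "\<eta> / 2 \<le> \<bar>m * b - x - of_int (k + 1)\<bar>"
      using b nint_dist_le[of "m * b - x"] order_trans by blast+
    moreover have "of_int k \<le> m * b - x" "m * b - x < of_int k + 1"
      unfolding k_def by linarith+
    ultimately have k: "x + of_int k + \<eta> / 2 \<le> m * b" "m * b \<le> x + of_int k + 1 - \<eta> / 2"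
      by auto
    have "m * a \<le> m * b" "m * b \<le> m * (a + l)"
      using b m_pos by (auto intro!: mult_left_mono)
    then have "k \<in> I" using k by (auto simp: I_def ceiling_le_iff le_floor_iff)
    then show "b \<in> (\<Union>k\<in>I. S \<inter> {u k..u k + w})"
      using b k by (auto simp: u_le uw_ge)
  qed
  \<comment> \<open>The bound \<eta> \<le> 1/2 enters here: each piece reaches the minimal length
    required by \<open>H\<close>.\<close>
  have "1 / (2 * m) \<le> w"
    using \<eta> m_pos by (simp add: w_def field_simps)
  then have piece: "measure lborel (S \<inter> {u k..u k + w}) \<le> c * w" for k
    by (rule H)
  have "(0::real) \<le> 1 / (2 * m)" using m_pos by simp
  then have w_nonneg: "0 \<le> w" using \<open>1 / (2 * m) \<le> w\<close> by linarith
  have fm: "S \<inter> {s..t} \<in> fmeasurable lborel" for s t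
    using S by (rule fmeasurable_borel_Int_Icc)
  have cardI: "real (card I) \<le> m * l + 2"
  proof -
    have "real_of_int (\<lfloor>m * (a + l) - x - \<eta> / 2\<rfloor> + 1 - \<lceil>m * a - x - 1 + \<eta> / 2\<rceil>) \<le> m * l + 2"
      using \<eta> by (simp add: algebra_simps) linarith
    moreover have "0 \<le> m * l + 2" using m_pos l_pos by simp
    ultimately show ?thesis by (simp add: I_def)
  qed
  have "measure lborel ({b \<in> S. \<eta> / 2 \<le> nint_dist (m * b - x)} \<inter> {a..a + l})
      \<le> measure lborel (\<Union>k\<in>I. S \<inter> {u k..u k + w})"
    using fm by (intro measure_mono_fmeasurable sub fmeasurable.finite_UN) (auto simp: I_def)
  also have "\<dots> \<le> (\<Sum>k\<in>I. measure lborel (S \<inter> {u k..u k + w}))"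
    using fm by (intro measure_UNION_le) (auto simp: I_def fmeasurableD)
  also have "\<dots> \<le> (\<Sum>k\<in>I. c * w)" by (intro sum_mono piece)
  also have "\<dots> \<le> (m * l + 2) * (c * w)"
    using cardI c w_nonneg by (simp add: mult_right_mono)
  also have "\<dots> = c * ((1 - \<eta>) * (l + 2 / m))"
    using m_pos by (simp add: w_def field_simps)
  also have "\<dots> \<le> c * ((1 - \<eta>) * (l + \<eta> / 2 * l))"
  proof -
    \<comment> \<open>The growth factor 8/\<eta> and \<open>l\<close> \<ge> 1/(2 m0) give \<eta> m l
      \<ge> 4, so the boundary surplus 2/m is at most (\<eta>/2) l.\<close>
    have "8 * m0 \<le> \<eta> * m" using m \<eta> by (simp add: field_simps)
    then have "8 * m0 * l \<le> \<eta> * m * l" using l_pos by (intro mult_right_mono) auto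
    moreover have "1 \<le> 2 * m0 * l" using l m0 by (simp add: field_simps)
    ultimately have "4 \<le> \<eta> * m * l" by linarith
    then have "2 / m \<le> \<eta> / 2 * l" using m_pos by (simp add: field_simps)
    then show ?thesis using \<eta> c by (intro mult_left_mono add_left_mono) auto
  qed
  also have "\<dots> = c * (1 - \<eta> / 2) * l - c * l * (\<eta>\<^sup>2 / 2)"
    by (simp add: field_simps power2_eq_square)
  also have "\<dots> \<le> c * (1 - \<eta> / 2) * l" using c l_pos by simp
  finally show ?thesis .
qed

lemma measure_avoid_arc:
  fixes m :: "nat \<Rightarrow> real"
  assumes \<eta>: "0 < \<eta>" "\<eta> \<le> 1 / 2" and m0: "\<And>k. 0 < m k" and m: "\<And>k. 8 / \<eta> * m k \<le> m (Suc k)"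
    and l: "1 / (2 * m i) \<le> l"
  shows "measure lborel ({b. \<forall>k\<in>{i<..i + d}. \<eta> / 2 \<le> nint_dist (m k * b - x)} \<inter> {a..a + l})
    \<le> (1 - \<eta> / 2) ^ d * l"
  using l
proof (induction d arbitrary: i a l)
  case 0
  have "0 < 1 / (2 * m i)" using m0 by simp
  then have "0 \<le> l" using 0 by linarith
  then show ?case by simp
next
  case (Suc d)
  \<comment> \<open>The slowest dilate, at index \<open>Suc i\<close>, is peeled off. The faster
    ones are controlled by the induction hypothesis on every interval of length at least 1/(2 m) for
    that dilate.\<close>
  let ?S = "{b. \<forall>k\<in>{Suc i<..Suc i + d}. \<eta> / 2 \<le> nint_dist (m k * b - x)}"
  have eq: "{b. \<forall>k\<in>{i<..i + Suc d}. \<eta> / 2 \<le> nint_dist (m k * b - x)}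
      = {b \<in> ?S. \<eta> / 2 \<le> nint_dist (m (Suc i) * b - x)}"
  proof -
    have "{i<..i + Suc d} = insert (Suc i) {Suc i<..Suc i + d}" by auto
    then show ?thesis by auto
  qed
  have "measure lborel ({b \<in> ?S. \<eta> / 2 \<le> nint_dist (m (Suc i) * b - x)} \<inter> {a..a + l})
    \<le> (1 - \<eta> / 2) ^ d * (1 - \<eta> / 2) * l"
  proof (rule measure_avoid_step[where ?m0.0 = "m i"])
    show "?S \<in> sets borel" by measurable
    show "measure lborel (?S \<inter> {a..a + l}) \<le> (1 - \<eta> / 2) ^ d * l"
      if "1 / (2 * m (Suc i)) \<le> l" for a l
      using that by (rule Suc.IH)
  qed (use \<eta> m0 m Suc.prems in auto)
  then show ?case unfolding eq by (simp add: mult.commute)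
qed

section \<open>Dispersion of a lacunary sequence for almost every \<beta>\<close>

lemma grid_approximation:
  assumes "0 < M"
  obtains i :: nat and k :: int where "i < M" "\<bar>real i / real M - \<delta> - of_int k\<bar> \<le> 1 / real M"
proof -
  define r where "r = \<lfloor>\<delta> * real M\<rfloor>"
  define i where "i = nat (r mod int M)"
  have i: "int i = r mod int M" using assms by (simp add: i_def)
  have "i < M" using i assms by (metis of_nat_0_less_iff of_nat_less_iff pos_mod_bound)
  have "r = int i + int M * (r div int M)" using i by simp
  then have r: "real_of_int r = real i + real M * of_int (r div int M)"
    by (metis of_int_add of_int_mult of_int_of_nat_eq)
  have "real M * (real i / real M - \<delta> - of_int (- (r div int M))) = real_of_int r - \<delta> * real M"
    using assms unfolding r by (simp add: algebra_simps)
  moreover have "\<bar>real_of_int r - \<delta> * real M\<bar> \<le> 1" unfolding r_def by linarith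
  ultimately have "\<bar>real M\<bar> * \<bar>real i / real M - \<delta> - of_int (- (r div int M))\<bar> \<le> 1"
    by (metis abs_mult)
  then have "\<bar>real i / real M - \<delta> - of_int (- (r div int M))\<bar> \<le> 1 / real M"
    using assms by (simp add: field_simps)
  with \<open>i < M\<close> show thesis by (rule that)
qed

text \<open>A finite grid of centres makes the result uniform in \<delta>, so \<delta> can stand
  inside the almost-everywhere quantifier.\<close>

lemma lacunary_dispersion:
  fixes n :: "nat \<Rightarrow> real"
  assumes n0: "1 \<le> n 0" and lac: "\<And>t. 2 * n t \<le> n (Suc t)"
  shows "AE \<beta> in lborel. \<forall>\<^sub>F j in sequentially. \<forall>\<delta>.
    \<exists>t\<in>{j..(j + 2) * (2 * j * 2 ^ j)}. nint_dist (n t * \<beta> - \<delta>) < 2 / 2 ^ j"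
proof -
  have pow: "2 ^ r * n t \<le> n (t + r)" for t r
  proof (induction r)
    case (Suc r)
    then show ?case using lac[of "t + r"] by simp
  qed simp
  have n_pos: "0 < n t" for t
  proof -
    have "0 < 2 ^ t * n 0" using n0 by simp
    then show ?thesis using pow[of t 0] by simp
  qed
  \<comment> \<open>The arc length is \<eta> = 2/2^j. Thinning by j + 2 yields the growth 2^(j+2) =
    8/\<eta>, and 2 j 2^j factors 1 - 2^(-j) multiply to at most exp(-2j).\<close>
  define A where "A j i = {b. \<forall>k\<in>{0<..0 + 2 * j * 2 ^ j}.
      (2 / 2 ^ j) / 2 \<le> nint_dist (n ((j + 2) * k) * b - real i / real (2 ^ j))}" for j i :: nat
  have A_sets [measurable]: "A j i \<in> sets borel" for j i
    unfolding A_def by measurable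
  have A_measure: "measure lborel (A j i \<inter> {a..a + l}) \<le> exp (- 2 * real j) * l"
    if "2 \<le> j" "1 \<le> l" for j i a l
  proof -
    have "(2::real) ^ 2 \<le> 2 ^ j" using that by (intro power_increasing) auto
    then have j: "(4::real) \<le> 2 ^ j" by simp
    have "measure lborel (A j i \<inter> {a..a + l}) \<le> (1 - (2 / 2 ^ j) / 2) ^ (2 * j * 2 ^ j) * l"
      unfolding A_def
    proof (rule measure_avoid_arc)
      show "(2::real) / 2 ^ j \<le> 1 / 2" using j by (simp add: field_simps)
      show "8 / (2 / 2 ^ j) * n ((j + 2) * k) \<le> n ((j + 2) * Suc k)" for k
        using pow[of "j + 2" "(j + 2) * k"] by (simp add: algebra_simps power_add)
      have "1 / (2 * n 0) \<le> 1" using n0 by simp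
      then show "1 / (2 * n ((j + 2) * 0)) \<le> l" using that by simp
    qed (use n_pos in auto)
    also have "\<dots> \<le> exp (- (1 / 2 ^ j)) ^ (2 * j * 2 ^ j) * l"
    proof -
      have "1 - (2 / 2 ^ j) / 2 \<le> exp (- (1 / 2 ^ j :: real))"
        using exp_ge_add_one_self[of "- (1 / 2 ^ j :: real)"] by simp
      then show ?thesis using that j by (intro mult_right_mono power_mono) (auto simp: field_simps)
    qed
    also have "exp (- (1 / 2 ^ j :: real)) ^ (2 * j * 2 ^ j) = exp (- 2 * real j)"
      by (subst exp_of_nat_mult[symmetric]) simp
    finally show ?thesis .
  qed
  \<comment> \<open>The window [-N, N+1] has length at least 1 even for N = 0, as
    \<open>A_measure\<close> requires.\<close>
  define B where "B N j = (\<Union>i<2 ^ j. A j i \<inter> {- real N..- real N + (2 * real N + 1)})" for N j :: nat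
  have fm: "A j i \<inter> {s..t} \<in> fmeasurable lborel" for j i s t
    by (rule fmeasurable_borel_Int_Icc[OF A_sets])
  have B_fm: "B N j \<in> fmeasurable lborel" for N j
    unfolding B_def using fm by (intro fmeasurable.finite_UN) auto
  have B_measure: "measure lborel (B N j) \<le> exp (-1) ^ j * (2 * real N + 1)" if "2 \<le> j" for N j
  proof -
    have "measure lborel (B N j) \<le> (\<Sum>i<2 ^ j. measure lborel (A j i \<inter> {- real N..- real N + (2 * real N + 1)}))"
      unfolding B_def using fm by (intro measure_UNION_le) (auto simp: fmeasurableD)
    also have "\<dots> \<le> (\<Sum>i<(2::nat) ^ j. exp (- 2 * real j) * (2 * real N + 1))"
      using that by (intro sum_mono A_measure) auto
    also have "\<dots> = 2 ^ j * exp (- 2 * real j) * (2 * real N + 1)" by simp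
    \<comment> \<open>With 2 \<le> e, the union over 2^j centres still leaves the summable bound
      exp(-j).\<close>
    also have "\<dots> \<le> exp 1 ^ j * exp (- 2 * real j) * (2 * real N + 1)"
      using exp_ge_add_one_self[of 1] by (intro mult_right_mono power_mono) auto
    also have "exp 1 ^ j * exp (- 2 * real j) = exp (-1) ^ j"
      by (simp add: exp_of_nat_mult[symmetric] exp_add[symmetric])
    finally show ?thesis .
  qed
  have "AE \<beta> in lborel. \<forall>\<^sub>F j in sequentially. \<beta> \<in> space lborel - B N j" for N
  proof (rule borel_cantelli_AE1)
    show "B N j \<in> sets lborel" for j using B_fm by (rule fmeasurableD)
    show "emeasure lborel (B N j) < \<infinity>" for j using B_fm by (simp add: fmeasurable_def)
    have "summable (\<lambda>j. exp (-1) ^ j * (2 * real N + 1))"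
      by (intro summable_mult2 summable_geometric) auto
    then show "summable (\<lambda>j. measure lborel (B N j))"
      by (rule summable_comparison_test[rotated]) (use B_measure in auto)
  qed
  then have "AE \<beta> in lborel. \<forall>N. \<forall>\<^sub>F j in sequentially. \<beta> \<in> space lborel - B N j"
    by (simp add: AE_all_countable)
  then show ?thesis
  proof (rule AE_mp, intro AE_I2 impI)
    fix \<beta> :: real
    assume *: "\<forall>N. \<forall>\<^sub>F j in sequentially. \<beta> \<in> space lborel - B N j"
    obtain N :: nat where N: "\<bar>\<beta>\<bar> \<le> real N" using real_arch_simple by blast
    have "\<forall>\<^sub>F j in sequentially. \<beta> \<in> space lborel - B N j" using * by blast
    then show "\<forall>\<^sub>F j in sequentially. \<forall>\<delta>.
      \<exists>t\<in>{j..(j + 2) * (2 * j * 2 ^ j)}. nint_dist (n t * \<beta> - \<delta>) < 2 / 2 ^ j"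
    proof (rule eventually_mono, intro allI)
      fix j \<delta>
      assume j: "\<beta> \<in> space lborel - B N j"
      obtain i :: nat and k :: int where i: "i < 2 ^ j"
        "\<bar>real i / real (2 ^ j) - \<delta> - of_int k\<bar> \<le> 1 / real (2 ^ j)"
        using grid_approximation[of "2 ^ j" \<delta>] by auto
      have "\<beta> \<notin> A j i" using j N i(1) by (auto simp: B_def)
      then obtain s where s: "s \<in> {0<..2 * j * 2 ^ j}"
        "nint_dist (n ((j + 2) * s) * \<beta> - real i / real (2 ^ j)) < 1 / 2 ^ j"
        by (auto simp: A_def not_le)
      have "nint_dist (n ((j + 2) * s) * \<beta> - \<delta>)
          \<le> nint_dist (n ((j + 2) * s) * \<beta> - real i / real (2 ^ j))
            + \<bar>real i / real (2 ^ j) - \<delta> - of_int k\<bar>"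
        using nint_dist_triangle[of "n ((j + 2) * s) * \<beta> - real i / real (2 ^ j)"
          "real i / real (2 ^ j) - \<delta>" k] by simp
      also have "\<dots> < 2 / 2 ^ j" using s(2) i(2) by simp
      finally have "nint_dist (n ((j + 2) * s) * \<beta> - \<delta>) < 2 / 2 ^ j" .
      \<comment> \<open>The lower end follows from s \<ge> 1 and later makes the solutions
        unbounded; the upper end controls their logarithm.\<close>
      moreover have "(j + 2) * s \<in> {j..(j + 2) * (2 * j * 2 ^ j)}"
      proof -
        have "(j + 2) * 1 \<le> (j + 2) * s" "(j + 2) * s \<le> (j + 2) * (2 * j * 2 ^ j)"
          using s(1) by (intro mult_left_mono; simp)+
        then show ?thesis by simp
      qed
      ultimately show "\<exists>t\<in>{j..(j + 2) * (2 * j * 2 ^ j)}. nint_dist (n t * \<beta> - \<delta>) < 2 / 2 ^ j"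
        by blast
    qed
  qed
qed

section \<open>Combination for elements of \<open>K_set\<close>\<close>

lemma K_set_lacunary_approximants:
  assumes "\<alpha> \<in> K_set"
  obtains n :: "nat \<Rightarrow> nat" and C :: real where "1 \<le> n 0" "\<And>t. 2 * n t \<le> n (Suc t)"
    "\<And>t. real (n t) * nint_dist (real (n t) * \<alpha> - \<gamma>) \<le> 5"
    "0 < C" "\<And>t. 1 \<le> t \<Longrightarrow> ln (real (n t)) \<le> C * real t"
proof -
  have irr: "\<alpha> \<notin> \<rat>" using assms by (simp add: K_set_def)
  have "\<exists>n :: nat. cf_denom \<alpha> (4 * t) \<le> int n \<and> int n < 2 * cf_denom \<alpha> (4 * t)
      \<and> real n * nint_dist (real n * \<alpha> - \<gamma>) \<le> 5" for t
    using inhomogeneous_approximation[OF irr, of "4 * t" \<gamma>] by blast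
  then obtain n :: "nat \<Rightarrow> nat" where n: "\<And>t. cf_denom \<alpha> (4 * t) \<le> int (n t)"
      "\<And>t. int (n t) < 2 * cf_denom \<alpha> (4 * t)"
      "\<And>t. real (n t) * nint_dist (real (n t) * \<alpha> - \<gamma>) \<le> 5"
    by metis
  obtain C where C: "\<And>t. 1 \<le> t \<Longrightarrow> ln (real_of_int (cf_denom \<alpha> t)) / real t \<le> C"
    using assms unfolding K_set_def bdd_above_def by blast
  show thesis
  proof (rule that)
    show "1 \<le> n 0" using n(1)[of 0] by simp
    show "2 * n t \<le> n (Suc t)" for t
    proof -
      have *: "4 * Suc t = Suc (Suc (Suc (Suc (4 * t))))" by simp
      \<comment> \<open>Four indices give a factor 4: one factor 2 absorbs the uncertainty of
        \<open>n t\<close> within [q, 2q), the other gives lacunarity.\<close>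
      have "4 * cf_denom \<alpha> (4 * t) \<le> cf_denom \<alpha> (4 * Suc t)"
        using cf_denom_double[OF irr, of "4 * t"] cf_denom_double[OF irr, of "Suc (Suc (4 * t))"]
        unfolding * by linarith
      then show ?thesis using n(1)[of "Suc t"] n(2)[of t] by linarith
    qed
    show "real (n t) * nint_dist (real (n t) * \<alpha> - \<gamma>) \<le> 5" for t by (rule n(3))
    \<comment> \<open>The 4 comes from the index 4t, and the 1 absorbs ln 2 since t \<ge> 1; the
      absolute value makes the constant positive.\<close>
    show "0 < 4 * \<bar>C\<bar> + 1" by simp
    show "ln (real (n t)) \<le> (4 * \<bar>C\<bar> + 1) * real t" if "1 \<le> t" for t
    proof -
      let ?q = "real_of_int (cf_denom \<alpha> (4 * t))"
      have q: "1 \<le> ?q" "?q \<le> real (n t)" "real (n t) \<le> 2 * ?q"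
        using cf_denom_mono[OF irr, of "4 * t"] n(1,2)[of t] by linarith+
      have "ln (real (n t)) \<le> ln (2 * ?q)" using q by simp
      also have "\<dots> = ln 2 + ln ?q" using q by (simp add: ln_mult)
      also have "ln 2 \<le> (1::real)" using ln_le_minus_one[of 2] by simp
      also have "ln ?q \<le> C * real (4 * t)"
        using C[of "4 * t"] that by (simp add: field_simps)
      also have "\<dots> \<le> \<bar>C\<bar> * real (4 * t)" by (intro mult_right_mono) auto
      finally show ?thesis using that by (simp add: algebra_simps)
    qed
  qed
qed

lemma AE_single_approximation:
  fixes \<epsilon> :: real
  assumes "\<epsilon> > 0" and "\<alpha> \<in> K_set"
  shows "AE \<beta> in lborel. \<forall>\<delta>::real.
    infinite {n::nat. n \<ge> 1 \<and>
      real n * nint_dist (real n * \<alpha> - \<gamma>) * nint_dist (real n * \<beta> - \<delta>)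
        < ln (ln (ln (real n))) powr (\<epsilon> + 1/2) / ln (real n) powr (1/2)}"
proof -
  obtain n :: "nat \<Rightarrow> nat" and C :: real where n: "1 \<le> n 0" "\<And>t. 2 * n t \<le> n (Suc t)"
    "\<And>t. real (n t) * nint_dist (real (n t) * \<alpha> - \<gamma>) \<le> 5"
    and C: "0 < C" "\<And>t. 1 \<le> t \<Longrightarrow> ln (real (n t)) \<le> C * real t"
    using K_set_lacunary_approximants[OF assms(2)] by metis
  have n_ge: "t < n t" for t
  proof (induction t)
    case (Suc t)
    then show ?case using n(2)[of t] by linarith
  qed (use n(1) in simp)
  \<comment> \<open>The left side is 5 times the dispersion 2/2^j; the right side decays only like
    2^(-j/2)/j.\<close>
  have small: "\<forall>\<^sub>F j in sequentially.
      10 / 2 ^ j < 1 / (C * real ((j + 2) * (2 * j * 2 ^ j))) powr (1/2)"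
    using C(1) by real_asymp
  have large: "\<forall>\<^sub>F j in sequentially. 1 \<le> ln (ln (ln (real j)))"
    by real_asymp
  have "AE \<beta> in lborel. \<forall>\<^sub>F j in sequentially. \<forall>\<delta>.
      \<exists>t\<in>{j..(j + 2) * (2 * j * 2 ^ j)}. nint_dist (real (n t) * \<beta> - \<delta>) < 2 / 2 ^ j"
  proof (rule lacunary_dispersion)
    show "2 * real (n t) \<le> real (n (Suc t))" for t
      using n(2)[of t] by linarith
  qed (use n(1) in simp)
  then show ?thesis
  proof (rule AE_mp, intro AE_I2 impI allI)
    fix \<beta> \<delta> :: real
    assume *: "\<forall>\<^sub>F j in sequentially. \<forall>\<delta>.
      \<exists>t\<in>{j..(j + 2) * (2 * j * 2 ^ j)}. nint_dist (real (n t) * \<beta> - \<delta>) < 2 / 2 ^ j"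
    obtain L where L: "\<And>j. j \<ge> L \<Longrightarrow> 1 \<le> ln (ln (ln (real j)))"
      using large by (auto simp: eventually_sequentially)
    show "infinite {n::nat. n \<ge> 1 \<and>
      real n * nint_dist (real n * \<alpha> - \<gamma>) * nint_dist (real n * \<beta> - \<delta>)
        < ln (ln (ln (real n))) powr (\<epsilon> + 1/2) / ln (real n) powr (1/2)}"
      unfolding infinite_nat_iff_unbounded_le
    proof
      fix m :: nat
      have "\<forall>\<^sub>F j in sequentially. max m (max L 3) \<le> j"
        by (rule eventually_ge_at_top)
      then have "\<forall>\<^sub>F j in sequentially. max m (max L 3) \<le> j
          \<and> 10 / 2 ^ j < 1 / (C * real ((j + 2) * (2 * j * 2 ^ j))) powr (1/2)
          \<and> (\<exists>t\<in>{j..(j + 2) * (2 * j * 2 ^ j)}. nint_dist (real (n t) * \<beta> - \<delta>) < 2 / 2 ^ j)"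
        using small * by eventually_elim blast
      then obtain j where j: "max m (max L 3) \<le> j"
        "10 / 2 ^ j < 1 / (C * real ((j + 2) * (2 * j * 2 ^ j))) powr (1/2)"
        and "\<exists>t\<in>{j..(j + 2) * (2 * j * 2 ^ j)}. nint_dist (real (n t) * \<beta> - \<delta>) < 2 / 2 ^ j"
        using eventually_happens'[OF sequentially_bot] by blast
      then obtain t where t: "j \<le> t" "t \<le> (j + 2) * (2 * j * 2 ^ j)"
          "nint_dist (real (n t) * \<beta> - \<delta>) < 2 / 2 ^ j"
        by auto
      \<comment> \<open>As n_t > t \<ge> j, every threshold imposed on \<open>j\<close> passes to
        \<open>n t\<close>; the 3 ensures a positive logarithm.\<close>
      have nt: "m \<le> n t" "L \<le> n t" "3 \<le> n t"
        using n_ge[of t] j t by linarith+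
      have ln_pos: "0 < ln (real (n t))" using nt by simp
      have "ln (real (n t)) \<le> C * real t" using C(2) j t by simp
      also have "\<dots> \<le> C * real ((j + 2) * (2 * j * 2 ^ j))"
        using C(1) t(2) by (intro mult_left_mono of_nat_mono) auto
      finally have ln_le: "ln (real (n t)) powr (1/2) \<le> (C * real ((j + 2) * (2 * j * 2 ^ j))) powr (1/2)"
        using ln_pos by (intro powr_mono2) auto
      have "real (n t) * nint_dist (real (n t) * \<alpha> - \<gamma>) * nint_dist (real (n t) * \<beta> - \<delta>)
          \<le> 5 * (2 / 2 ^ j)"
        using n(3)[of t] t(3) by (intro mult_mono nint_dist_nonneg) auto
      also have "\<dots> < 1 / (C * real ((j + 2) * (2 * j * 2 ^ j))) powr (1/2)"
        using j(2) by simp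
      also have "\<dots> \<le> 1 / ln (real (n t)) powr (1/2)"
        by (rule frac_le[OF _ _ _ ln_le]) (use ln_pos in auto)
      also have "\<dots> \<le> ln (ln (ln (real (n t)))) powr (\<epsilon> + 1/2) / ln (real (n t)) powr (1/2)"
        using L[OF nt(2)] assms(1) by (intro divide_right_mono ge_one_powr_ge_zero) auto
      finally show "\<exists>k\<ge>m. k \<in> {n::nat. n \<ge> 1 \<and>
        real n * nint_dist (real n * \<alpha> - \<gamma>) * nint_dist (real n * \<beta> - \<delta>)
          < ln (ln (ln (real n))) powr (\<epsilon> + 1/2) / ln (real n) powr (1/2)}"
        using nt by (intro exI[of _ "n t"]) auto
    qed
  qed
qed

theorem theorem1p5:
  fixes \<epsilon> :: real and \<alpha> \<gamma> :: "nat \<Rightarrow> real"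
  assumes "\<epsilon> > 0"
    and "\<And>i. i \<ge> 1 \<Longrightarrow> \<alpha> i \<in> K_set"
  shows "AE \<beta> in lebesgue. \<forall>i\<ge>1. \<forall>\<delta>::real.
    infinite {n::nat. n \<ge> 1 \<and>
      real n * nint_dist (real n * \<alpha> i - \<gamma> i) * nint_dist (real n * \<beta> - \<delta>)
        < ln (ln (ln (real n))) powr (\<epsilon> + 1/2) / ln (real n) powr (1/2)}"
proof (rule AE_completion)
  show "AE \<beta> in lborel. \<forall>i\<ge>1. \<forall>\<delta>::real.
    infinite {n::nat. n \<ge> 1 \<and>
      real n * nint_dist (real n * \<alpha> i - \<gamma> i) * nint_dist (real n * \<beta> - \<delta>)
        < ln (ln (ln (real n))) powr (\<epsilon> + 1/2) / ln (real n) powr (1/2)}"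
    \<comment> \<open>Only the countable quantifier over \<open>i\<close> has to be interchanged
      with the almost-everywhere quantifier; \<delta> is already handled uniformly for each
      \<open>i\<close>.\<close>
    unfolding AE_all_countable
    using AE_single_approximation[OF assms(1) assms(2)] by (intro allI AE_impI) blast
qed

end
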